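(* Let $0<c<1$ and $\varepsilon>0$ be real numbers, and let $k$ be a positive integer such that $$\exp\left(\tfrac12\varepsilon^2(k-1)\right)>k.$$ If $H$ is a graph of order $\ell\ge k$ such that $\delta(H)\ge c\ell$, then there exists $S\subseteq V(H)$ of order $k$ such that $\delta(H[S])\ge (c-\varepsilon)(k-1)$.
   Context: Graphs are finite and simple. $\delta(\cdot)$ denotes the minimum degree of a graph, $V(H)$ the vertex set of $H$, and $H[S]$ the subgraph of $H$ induced by $S$. The order of a graph is its number of vertices, and the order of a vertex set is its cardinality. *)

theory Defs
  imports Complex_Main "Graph_Theory.Graph_Theory"
begin

(* The locale predicate graph of the Graph_Theory entry describes finite simple graphs: finite,
   loop-free digraphs without parallel arcs whose adjacency relation is symmetric. Each undirected
   edge {u, v} is thus represented by the two arcs u -> v and v -> u, and the out-degree of a vertex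
   is its number of neighbours, i.e. its degree as a vertex of the undirected graph.
   The value of min_degree on the graph without vertices is unspecified. *)
definition min_degree :: "('a, 'b) pre_digraph \<Rightarrow> nat" where
  "min_degree G = Min (out_degree G ` verts G)"

end

theory Submission
  imports Defs "HOL-Probability.Hoeffding"
begin

text \<open>
  A uniformly random \<open>k\<close>-subset \<open>S\<close> of the vertices works with positive probability. Condition on
  a vertex \<open>v\<close> lying in \<open>S\<close>: the remaining \<open>k - 1\<close> vertices are then a uniform sample without
  replacement from the other \<open>l - 1\<close> vertices, at least a proportion \<open>c\<close> of which are neighbours
  of \<open>v\<close>. So the degree of \<open>v\<close> inside \<open>S\<close> is hypergeometric with mean at least
  \<open>c * (k - 1)\<close>, and it falls below \<open>(c - \<epsilon>) * (k - 1)\<close> with probability at most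
  \<open>exp (- 2 * \<epsilon>\<^sup>2 * (k - 1))\<close>, which is less than \<open>1 / k\<close> because
  already \<open>exp (- 1 / 2 * \<epsilon>\<^sup>2 * (k - 1))\<close> is. Since \<open>S\<close> has \<open>k\<close> vertices, a union
  bound leaves an \<open>S\<close> in which no degree is too small. Probabilities are expressed as counts of
  subsets throughout; the union bound is \<open>exists_subset_with_high_degrees\<close>.

  The tail bound \<open>card_subsets_large_Int_le\<close> is Hoeffding's inequality for sampling without
  replacement. The coordinates of such a sample are dependent, so the version for independent
  variables does not apply. Its proof still does: by \<open>sum_over_subsets_of_power_card_Int_le\<close> the
  moment generating function of the hypergeometric distribution is at most that of the binomial
  distribution with the same number of draws and the same proportion, and Markov's inequality
  finishes as in the independent case.
\<close>

section \<open>Sampling without replacement\<close>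

text \<open>
  After division by \<open>N choose j\<close> this compares the probability that \<open>j\<close> draws all hit a fixed set
  of \<open>b\<close> among \<open>N\<close> elements: without replacement the success probability of each further draw is
  \<open>(b - i) / (N - i)\<close>, which is at most \<open>b / N\<close>.
\<close>
lemma binomial_le_binomial_mult_power:
  fixes b N j :: nat
  assumes "b \<le> N"
  shows "real (b choose j) \<le> real (N choose j) * (real b / real N) ^ j"
proof (induction j)
  case 0
  then show ?case by simp
next
  case (Suc j)
  show ?case
  proof (cases "j < b")
    case False
    then have zero: "b choose Suc j = 0" by simp
    show ?thesis unfolding zero by simp
  next
    case True
    have step: "real (n choose Suc j) = real (n choose j) * (real n - real j) / (real j + 1)"
      if "j < n" for n
    proof -
      have "Suc j * (n choose Suc j) = (n - j) * (n choose j)"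
        using binomial_absorption[of j n] binomial_absorb_comp[of n j] by simp
      then have "real (Suc j) * real (n choose Suc j) = real (n - j) * real (n choose j)"
        by (simp only: of_nat_mult [symmetric])
      then show ?thesis using that by (simp add: field_simps of_nat_diff)
    qed
    have ratio: "real b - real j \<le> (real N - real j) * (real b / real N)"
    proof -
      have "real b * real j \<le> real N * real j"
        using assms by (intro mult_right_mono) auto
      then show ?thesis using True assms by (simp add: field_simps)
    qed
    have "real (b choose Suc j) = real (b choose j) * (real b - real j) / (real j + 1)"
      using step[OF True] .
    also have "\<dots> \<le> (real (N choose j) * (real b / real N) ^ j)
        * ((real N - real j) * (real b / real N)) / (real j + 1)"
      using Suc.IH ratio True by (intro divide_right_mono mult_mono) auto
    also have "\<dots> = real (N choose Suc j) * (real b / real N) ^ Suc j"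
      using step[of N] True assms by (simp add: mult_ac)
    finally show ?thesis .
  qed
qed

lemma card_supersets_of_size:
  assumes "finite W" "R \<subseteq> W" "card R \<le> n"
  shows "card {T. T \<subseteq> W \<and> card T = n \<and> R \<subseteq> T} = (card W - card R) choose (n - card R)"
proof -
  have fin: "finite R" using assms finite_subset by blast
  have "bij_betw (\<lambda>U. U \<union> R) {U. U \<subseteq> W - R \<and> card U = n - card R}
      {T. T \<subseteq> W \<and> card T = n \<and> R \<subseteq> T}"
  proof (rule bij_betw_byWitness[where f' = "\<lambda>T. T - R"])
    show "(\<lambda>U. U \<union> R) ` {U. U \<subseteq> W - R \<and> card U = n - card R}
        \<subseteq> {T. T \<subseteq> W \<and> card T = n \<and> R \<subseteq> T}"
    proof clarsimp
      fix U assume U: "U \<subseteq> W - R" "card U = n - card R"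
      have "finite U" "U \<inter> R = {}" using U assms(1) by (auto intro: finite_subset)
      then show "U \<subseteq> W \<and> R \<subseteq> W \<and> card (U \<union> R) = n"
        using U assms fin by (auto simp: card_Un_disjoint)
    qed
    show "(\<lambda>T. T - R) ` {T. T \<subseteq> W \<and> card T = n \<and> R \<subseteq> T}
        \<subseteq> {U. U \<subseteq> W - R \<and> card U = n - card R}"
      using fin by (auto simp: card_Diff_subset)
  qed auto
  then have "card {T. T \<subseteq> W \<and> card T = n \<and> R \<subseteq> T}
      = card {U. U \<subseteq> W - R \<and> card U = n - card R}"
    by (simp add: bij_betw_same_card)
  also have "\<dots> = (card W - card R) choose (n - card R)"
    using n_subsets[of "W - R" "n - card R"] assms fin by (simp add: card_Diff_subset)
  finally show ?thesis .
qed

text \<open>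
  With \<open>x = 1 + y\<close> and after division by \<open>card W choose n\<close>, the generating function
  \<open>E (x ^ X)\<close> of a hypergeometric \<open>X\<close> is bounded by the one of the corresponding binomial variable.
  Expanding in powers of \<open>y\<close> turns the coefficients into factorial moments: the coefficient of
  \<open>y ^ j\<close> counts the \<open>j\<close>-subsets of \<open>B\<close> contained in the sample, and these are compared one by one
  by \<open>binomial_le_binomial_mult_power\<close>. The hypothesis \<open>y \<ge> 0\<close> lets the comparison of
  coefficients carry over to the sums.
\<close>
lemma sum_over_subsets_of_power_card_Int_le:
  fixes y :: real
  assumes W: "finite W" and B: "B \<subseteq> W" and n: "n \<le> card W" and y: "y \<ge> 0"
  shows "(\<Sum>T | T \<subseteq> W \<and> card T = n. (1 + y) ^ card (T \<inter> B))
    \<le> real (card W choose n) * (1 + real (card B) / real (card W) * y) ^ n"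
proof -
  define N b p where "N = card W" and "b = card B" and "p = real b / real N"
  have finB: "finite B" using W B finite_subset by blast
  have bN: "b \<le> N" using W B by (simp add: b_def N_def card_mono)
  define \<T> where "\<T> = {T. T \<subseteq> W \<and> card T = n}"
  define \<R> where "\<R> = (\<lambda>j. {R. R \<subseteq> B \<and> card R = j})"
  have fin\<T>: "finite \<T>" using W by (auto simp: \<T>_def)
  have fin\<R>: "finite (\<R> j)" for j using finB by (auto simp: \<R>_def)
  have expand: "(1 + y) ^ card (T \<inter> B) = (\<Sum>R\<in>{R \<in> Pow B. R \<subseteq> T}. y ^ card R)"
    for T
  proof -
    have "(1 + y) ^ card (T \<inter> B) = (\<Prod>x\<in>T \<inter> B. y + 1)" by (simp add: add.commute)
    also have "\<dots> = (\<Sum>R\<in>Pow (T \<inter> B). y ^ card R)"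
      using finB by (subst prod_add) auto
    also have "Pow (T \<inter> B) = {R \<in> Pow B. R \<subseteq> T}" by auto
    finally show ?thesis .
  qed
  have "(\<Sum>T\<in>\<T>. (1 + y) ^ card (T \<inter> B))
      = (\<Sum>R\<in>Pow B. \<Sum>T\<in>{T \<in> \<T>. R \<subseteq> T}. y ^ card R)"
    unfolding expand using fin\<T> finB by (intro sum.swap_restrict) auto
  also have "\<dots> = (\<Sum>R\<in>Pow B. real (card {T \<in> \<T>. R \<subseteq> T}) * y ^ card R)" by simp
  also have "\<dots> = (\<Sum>R\<in>(\<Union>j\<le>n. \<R> j). real (card {T \<in> \<T>. R \<subseteq> T}) * y ^ card R)"
  proof (rule sum.mono_neutral_right)
    show "finite (Pow B)" using finB by simp
    show "(\<Union>j\<le>n. \<R> j) \<subseteq> Pow B" by (auto simp: \<R>_def)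
    show "\<forall>R\<in>Pow B - (\<Union>j\<le>n. \<R> j). real (card {T \<in> \<T>. R \<subseteq> T}) * y ^ card R = 0"
    proof
      fix R assume R: "R \<in> Pow B - (\<Union>j\<le>n. \<R> j)"
      then have "card R > n" by (force simp: \<R>_def not_le[symmetric])
      have "\<not> R \<subseteq> T" if "T \<in> \<T>" for T
      proof
        assume "R \<subseteq> T"
        then have "card R \<le> card T"
          using that W by (intro card_mono) (auto simp: \<T>_def intro: finite_subset)
        then show False using \<open>card R > n\<close> that by (simp add: \<T>_def)
      qed
      then have empty: "{T \<in> \<T>. R \<subseteq> T} = {}" by blast
      show "real (card {T \<in> \<T>. R \<subseteq> T}) * y ^ card R = 0" unfolding empty by simp
    qed
  qed
  also have "\<dots> = (\<Sum>j\<le>n. \<Sum>R\<in>\<R> j. real (card {T \<in> \<T>. R \<subseteq> T}) * y ^ card R)"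
    using fin\<R> by (intro sum.UNION_disjoint) (auto simp: \<R>_def)
  also have "\<dots> = (\<Sum>j\<le>n. \<Sum>R\<in>\<R> j. real ((N - j) choose (n - j)) * y ^ j)"
  proof (intro sum.cong refl)
    fix j R assume "j \<in> {..n}" "R \<in> \<R> j"
    then have "R \<subseteq> W" "card R \<le> n" and j: "card R = j" using B by (auto simp: \<R>_def)
    from card_supersets_of_size[OF W this(1,2)] j
    show "real (card {T \<in> \<T>. R \<subseteq> T}) * y ^ card R = real ((N - j) choose (n - j)) * y ^ j"
      by (simp add: \<T>_def N_def conj_assoc)
  qed
  also have "\<dots> = (\<Sum>j\<le>n. real (b choose j) * real ((N - j) choose (n - j)) * y ^ j)"
    using n_subsets[OF finB] by (simp add: \<R>_def b_def mult.assoc)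
  also have "\<dots> \<le> (\<Sum>j\<le>n. real (N choose n) * (real (n choose j) * (p * y) ^ j))"
  proof (rule sum_mono)
    fix j assume j: "j \<in> {..n}"
    have "real (b choose j) * real ((N - j) choose (n - j)) * y ^ j
        \<le> (real (N choose j) * p ^ j) * real ((N - j) choose (n - j)) * y ^ j"
      using binomial_le_binomial_mult_power[OF bN] y
      by (intro mult_right_mono) (auto simp: p_def)
    also have "\<dots> = real ((N choose j) * ((N - j) choose (n - j))) * (p * y) ^ j"
      by (simp add: power_mult_distrib)
    also have "(N choose j) * ((N - j) choose (n - j)) = (N choose n) * (n choose j)"
      using choose_mult[of j n N] j n by (simp add: N_def)
    finally show "real (b choose j) * real ((N - j) choose (n - j)) * y ^ j
        \<le> real (N choose n) * (real (n choose j) * (p * y) ^ j)"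
      by (simp add: mult.assoc)
  qed
  also have "\<dots> = real (N choose n) * (p * y + 1) ^ n"
    by (simp add: binomial_ring sum_distrib_left)
  finally show ?thesis by (simp add: \<T>_def N_def b_def p_def add.commute)
qed

text \<open>
  Hoeffding's inequality for the hypergeometric distribution: Markov's inequality applied to
  \<open>exp (h * card (T \<inter> B))\<close>, whose mean is at most \<open>(1 + p * (exp h - 1)) ^ n\<close>. Hoeffding's lemma
  bounds this by \<open>exp (n * (h * p + h\<^sup>2 / 8))\<close>.
\<close>
lemma card_subsets_large_Int_le:
  fixes t :: real
  assumes W: "finite W" and B: "B \<subseteq> W" and n: "n \<le> card W" and t: "t \<ge> 0"
  shows "real (card {T. T \<subseteq> W \<and> card T = n \<and>
            real (card (T \<inter> B)) \<ge> (real (card B) / real (card W) + t) * real n})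
    \<le> real (card W choose n) * exp (- 2 * t\<^sup>2 * real n)"
proof -
  define p where "p = real (card B) / real (card W)"
  \<comment> \<open>The final exponent is \<open>n * (h\<^sup>2 / 8 - h * t)\<close>, which is minimal for this \<open>h\<close>.\<close>
  define h where "h = 4 * t"
  define \<T> where "\<T> = {T. T \<subseteq> W \<and> card T = n}"
  define \<B> where "\<B> = {T \<in> \<T>. real (card (T \<inter> B)) \<ge> (p + t) * real n}"
  have h: "h \<ge> 0" and p: "p \<ge> 0" using t by (auto simp: h_def p_def)
  have fin: "finite \<T>" using W by (auto simp: \<T>_def)
  have pos: "1 + p * (exp h - 1) > 0"
    using h p by (intro add_pos_nonneg mult_nonneg_nonneg) auto
  have "real (card \<B>) * exp (h * ((p + t) * real n)) = (\<Sum>T\<in>\<B>. exp (h * ((p + t) * real n)))"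
    by simp
  also have "\<dots> \<le> (\<Sum>T\<in>\<B>. (1 + (exp h - 1)) ^ card (T \<inter> B))"
  proof (rule sum_mono)
    fix T assume "T \<in> \<B>"
    then have "h * ((p + t) * real n) \<le> h * real (card (T \<inter> B))"
      using h by (intro mult_left_mono) (auto simp: \<B>_def)
    then show "exp (h * ((p + t) * real n)) \<le> (1 + (exp h - 1)) ^ card (T \<inter> B)"
      by (simp flip: exp_of_nat2_mult)
  qed
  also have "\<dots> \<le> (\<Sum>T\<in>\<T>. (1 + (exp h - 1)) ^ card (T \<inter> B))"
    using fin by (intro sum_mono2) (auto simp: \<B>_def)
  also have "\<dots> \<le> real (card W choose n) * (1 + p * (exp h - 1)) ^ n"
    unfolding \<T>_def p_def using sum_over_subsets_of_power_card_Int_le[OF W B n, of "exp h - 1"] h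
    by simp
  also have "\<dots> \<le> real (card W choose n) * exp (h * p + h\<^sup>2 / 8) ^ n"
  proof (intro mult_left_mono power_mono)
    have "ln (1 + p * (exp h - 1)) \<le> h * p + h\<^sup>2 / 8"
      using Hoeffdings_lemma_aux[OF h p] by simp
    then show "1 + p * (exp h - 1) \<le> exp (h * p + h\<^sup>2 / 8)"
      using pos by (metis exp_le_cancel_iff exp_ln)
  qed (use pos in auto)
  finally have "real (card \<B>) * exp (h * ((p + t) * real n))
      \<le> real (card W choose n) * exp ((h * p + h\<^sup>2 / 8) * real n)"
    by (simp add: exp_of_nat2_mult)
  then have "real (card \<B>)
      \<le> real (card W choose n) * exp ((h * p + h\<^sup>2 / 8) * real n) / exp (h * ((p + t) * real n))"
    by (simp add: pos_le_divide_eq)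
  also have "\<dots> = real (card W choose n)
      * exp ((h * p + h\<^sup>2 / 8) * real n - h * ((p + t) * real n))"
    by (simp add: exp_diff)
  also have "(h * p + h\<^sup>2 / 8) * real n - h * ((p + t) * real n) = - 2 * t\<^sup>2 * real n"
    by (simp add: h_def algebra_simps power2_eq_square)
  finally show ?thesis by (simp add: \<B>_def \<T>_def p_def conj_assoc)
qed

section \<open>Degrees in random subsets\<close>

text \<open>
  Removing \<open>v\<close> turns the sets counted here into \<open>(k - 1)\<close>-subsets of \<open>V - {v}\<close>. The tail bound
  controls large intersections, so it is applied to the set \<open>B\<close> of non-neighbours of \<open>v\<close>: few
  neighbours in the sample means many non-neighbours.
\<close>
lemma card_subsets_with_low_degree_le:
  fixes c t :: real and Nb :: "'a set"
  assumes V: "finite V" and v: "v \<in> V" and k: "0 < k" "k \<le> card V" and V2: "2 \<le> card V"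
    and Nb: "Nb \<subseteq> V - {v}" "real (card Nb) \<ge> c * (real (card V) - 1)" and t: "t \<ge> 0"
  shows "real (card {S. S \<subseteq> V \<and> card S = k \<and> v \<in> S \<and>
            real (card (Nb \<inter> S)) < (c - t) * (real k - 1)})
    \<le> real ((card V - 1) choose (k - 1)) * exp (- 2 * t\<^sup>2 * (real k - 1))"
proof -
  define W B where "W = V - {v}" and "B = V - {v} - Nb"
  let ?bad = "{S. S \<subseteq> V \<and> card S = k \<and> v \<in> S \<and> real (card (Nb \<inter> S)) < (c - t) * (real k - 1)}"
  let ?img = "{T. T \<subseteq> W \<and> card T = k - 1 \<and>
            real (card (T \<inter> B)) \<ge> (real (card B) / real (card W) + t) * real (k - 1)}"
  have W: "finite W" "card W = card V - 1" "B \<subseteq> W"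
    using V v by (auto simp: W_def B_def)
  have k1: "real (k - 1) = real k - 1" and l1: "real (card V - 1) = real (card V) - 1"
    using k V2 by (auto simp: of_nat_diff)
  have "card B = card W - card Nb"
    using Nb(1) W(1) unfolding B_def W_def by (intro card_Diff_subset finite_subset[OF Nb(1)]) auto
  moreover have "card Nb \<le> card W" using Nb(1) W(1) by (simp add: W_def card_mono)
  ultimately have "real (card B) = real (card W) - real (card Nb)" by (simp add: of_nat_diff)
  also have "\<dots> \<le> (1 - c) * real (card W)" using Nb(2) W(2) l1 by (simp add: algebra_simps)
  finally have p: "real (card B) / real (card W) \<le> 1 - c"
    using W(2) V2 by (simp add: pos_divide_le_eq)
  have "card ?bad \<le> card ?img"
  proof (rule card_inj_on_le[where f = "\<lambda>S. S - {v}"])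
    show "inj_on (\<lambda>S. S - {v}) ?bad" by (auto simp: inj_on_def)
    show "finite ?img" using W(1) by simp
    show "(\<lambda>S. S - {v}) ` ?bad \<subseteq> ?img"
    proof (rule image_subsetI)
      fix S assume "S \<in> ?bad"
      then have S: "S \<subseteq> V" "card S = k" "v \<in> S"
        and low: "real (card (Nb \<inter> S)) < (c - t) * (real k - 1)" by auto
      have finS: "finite S" using S V finite_subset by blast
      define T where "T = S - {v}"
      have T: "T \<subseteq> W" "card T = k - 1" "finite T"
        using S finS by (auto simp: T_def W_def)
      have "T = (Nb \<inter> S) \<union> (T \<inter> B)" "(Nb \<inter> S) \<inter> (T \<inter> B) = {}"
        using S Nb(1) by (auto simp: T_def B_def)
      then have "card T = card (Nb \<inter> S) + card (T \<inter> B)"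
        using T(3) finS by (metis card_Un_disjoint finite_Int)
      then have "real (card (T \<inter> B)) = real (k - 1) - real (card (Nb \<inter> S))" using T(2) by simp
      also have "\<dots> \<ge> (1 - c + t) * real (k - 1)" using low k1 by (simp add: algebra_simps)
      finally have "real (card (T \<inter> B)) \<ge> (1 - c + t) * real (k - 1)" .
      moreover have "(real (card B) / real (card W) + t) * real (k - 1) \<le> (1 - c + t) * real (k - 1)"
        using p by (intro mult_right_mono) auto
      ultimately show "S - {v} \<in> ?img" using T by (simp add: T_def)
    qed
  qed
  then have "real (card ?bad) \<le> real (card ?img)" by simp
  also have "\<dots> \<le> real (card W choose (k - 1)) * exp (- 2 * t\<^sup>2 * real (k - 1))"
    using card_subsets_large_Int_le[OF W(1,3) _ t, of "k - 1"] k W(2) by simp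
  finally show ?thesis using W(2) k1 by simp
qed

text \<open>
  If every \<open>k\<close>-subset contained a vertex of low degree, then counting pairs of a \<open>k\<close>-subset and
  such a vertex in it would give at most
  \<open>l * ((l - 1) choose (k - 1)) * e = (l choose k) * (k * e)\<close> subsets, where \<open>e\<close> is the tail
  bound. This is too few because \<open>k * e < 1\<close>.
\<close>
lemma exists_subset_with_high_degrees:
  fixes c t :: real and Nb :: "'a \<Rightarrow> 'a set"
  assumes V: "finite V" and k: "0 < k" "k \<le> card V" and t: "t \<ge> 0"
    and Nb: "\<And>v. v \<in> V \<Longrightarrow> Nb v \<subseteq> V - {v}"
      "\<And>v. v \<in> V \<Longrightarrow> real (card (Nb v)) \<ge> c * (real (card V) - 1)"
    and large: "exp (2 * t\<^sup>2 * (real k - 1)) > real k"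
  shows "\<exists>S \<subseteq> V. card S = k \<and> (\<forall>v\<in>S. real (card (Nb v \<inter> S)) \<ge> (c - t) * (real k - 1))"
proof (rule ccontr)
  assume none: "\<not> ?thesis"
  have "k \<noteq> 1" using large by auto
  with k have V2: "2 \<le> card V" by linarith
  define l where "l = card V"
  define bad where "bad = (\<lambda>v. {S. S \<subseteq> V \<and> card S = k \<and> v \<in> S \<and>
            real (card (Nb v \<inter> S)) < (c - t) * (real k - 1)})"
  let ?e = "exp (- 2 * t\<^sup>2 * (real k - 1))"
  have cover: "{S. S \<subseteq> V \<and> card S = k} \<subseteq> (\<Union>v\<in>V. bad v)"
    using none by (fastforce simp: bad_def not_le)
  have "real k * ?e < exp (2 * t\<^sup>2 * (real k - 1)) * ?e" using large by simp
  also have "\<dots> = 1" by (simp flip: exp_add)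
  finally have small: "real k * ?e < 1" .
  have "l choose k \<le> card (\<Union>v\<in>V. bad v)"
    using n_subsets[OF V, of k] card_mono[OF _ cover] V by (simp add: l_def bad_def)
  also have "\<dots> \<le> (\<Sum>v\<in>V. card (bad v))" using V by (rule card_UN_le)
  finally have "real (l choose k) \<le> real (\<Sum>v\<in>V. card (bad v))" by (simp only: of_nat_le_iff)
  also have "\<dots> = (\<Sum>v\<in>V. real (card (bad v)))" by simp
  also have "\<dots> \<le> (\<Sum>v\<in>V. real ((l - 1) choose (k - 1)) * ?e)"
    unfolding bad_def l_def
    by (intro sum_mono card_subsets_with_low_degree_le V k V2 t Nb)
  also have "\<dots> = real (l * ((l - 1) choose (k - 1))) * ?e" by (simp add: l_def)
  also have "l * ((l - 1) choose (k - 1)) = k * (l choose k)"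
    using times_binomial_minus1_eq[OF k(1), of l] by simp
  also have "real (k * (l choose k)) * ?e = real (l choose k) * (real k * ?e)" by simp
  also have "\<dots> < real (l choose k) * 1"
    using small k(2) by (intro mult_strict_left_mono) (auto simp: l_def)
  finally show False by simp
qed

section \<open>Transfer to graphs\<close>

lemma (in nomulti_digraph) out_degree_induce_subgraph:
  assumes "v \<in> S"
  shows "out_degree (G \<restriction> S) v = card ({w. v \<rightarrow>\<^bsub>G\<^esub> w} \<inter> S)"
proof -
  have "inj_on (head G) (out_arcs (G \<restriction> S) v)"
    by (rule inj_onI, rule no_multi_arcs) (auto simp: arc_to_ends_def)
  moreover have "head G ` out_arcs (G \<restriction> S) v = {w. v \<rightarrow>\<^bsub>G\<^esub> w} \<inter> S"
    using assms by (force simp: arcs_ends_conv)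
  ultimately show ?thesis unfolding out_degree_def by (metis card_image)
qed

lemma (in nomulti_digraph) out_degree_eq_card_dominated:
  "out_degree G v = card {w. v \<rightarrow>\<^bsub>G\<^esub> w}"
proof -
  have "inj_on (head G) (out_arcs G v)"
    by (rule inj_onI, rule no_multi_arcs) (auto simp: arc_to_ends_def)
  moreover have "head G ` out_arcs G v = {w. v \<rightarrow>\<^bsub>G\<^esub> w}"
    by (force simp: arcs_ends_conv)
  ultimately show ?thesis unfolding out_degree_def by (metis card_image)
qed

theorem lemma11:
  fixes c \<epsilon> :: real and k l :: nat and H :: "('a, 'b) pre_digraph"
  assumes "0 < c" and "c < 1" and "\<epsilon> > 0" and "k > 0"
    and "exp (1 / 2 * \<epsilon>\<^sup>2 * (real k - 1)) > real k"
    and "Digraph.graph H" and "card (verts H) = l" and "l \<ge> k"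
    and "real (min_degree H) \<ge> c * real l"
  shows "\<exists>S \<subseteq> verts H. card S = k \<and> real (min_degree (H \<restriction> S)) \<ge> (c - \<epsilon>) * (real k - 1)"
proof -
  interpret H: graph H by fact
  define Nb where "Nb = (\<lambda>v. {w. v \<rightarrow>\<^bsub>H\<^esub> w})"
  \<comment> \<open>For \<open>k = 1\<close> the hypothesis on \<open>k\<close> would read \<open>exp 0 > 1\<close>.\<close>
  have "k \<noteq> 1" using assms(5) by auto
  then have k2: "2 \<le> k" using assms(4) by simp
  have "\<exists>S \<subseteq> verts H. card S = k \<and> (\<forall>v\<in>S. real (card (Nb v \<inter> S)) \<ge> (c - \<epsilon>) * (real k - 1))"
  proof (rule exists_subset_with_high_degrees)
    fix v assume v: "v \<in> verts H"
    show "Nb v \<subseteq> verts H - {v}"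
      using H.adj_in_verts H.adj_not_same by (auto simp: Nb_def)
    have "min_degree H \<le> out_degree H v"
      unfolding min_degree_def using v by (intro Min_le) auto
    then have "c * real l \<le> real (card (Nb v))"
      using assms(9) by (simp add: Nb_def H.out_degree_eq_card_dominated)
    moreover have "c * (real (card (verts H)) - 1) \<le> c * real l"
      using assms(1,7) by simp
    ultimately show "c * (real (card (verts H)) - 1) \<le> real (card (Nb v))" by linarith
  next
    have "1 / 2 * \<epsilon>\<^sup>2 * (real k - 1) \<le> 2 * \<epsilon>\<^sup>2 * (real k - 1)"
      using k2 by (intro mult_right_mono) auto
    then have "exp (1 / 2 * \<epsilon>\<^sup>2 * (real k - 1)) \<le> exp (2 * \<epsilon>\<^sup>2 * (real k - 1))" by simp
    then show "real k < exp (2 * \<epsilon>\<^sup>2 * (real k - 1))" using assms(5) by linarith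
  qed (use assms k2 in auto)
  then obtain S where S: "S \<subseteq> verts H" "card S = k"
    and deg: "\<And>v. v \<in> S \<Longrightarrow> real (card (Nb v \<inter> S)) \<ge> (c - \<epsilon>) * (real k - 1)"
    by blast
  have "finite S" "S \<noteq> {}" using S k2 finite_subset[OF S(1)] by auto
  then have "min_degree (H \<restriction> S) \<in> out_degree (H \<restriction> S) ` S"
    using Min_in[of "out_degree (H \<restriction> S) ` S"] by (simp add: min_degree_def)
  then obtain v where "v \<in> S" "min_degree (H \<restriction> S) = out_degree (H \<restriction> S) v" by blast
  then have "real (min_degree (H \<restriction> S)) \<ge> (c - \<epsilon>) * (real k - 1)"
    using deg H.out_degree_induce_subgraph[of v S] by (simp add: Nb_def)
  with S show ?thesis by blast
qed

end
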